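(* Let $k\ge 4$ be an integer and let $G$ be a graph with $m(G)<m_2(K_k)$. Then $G\not\to\mathrm{TT}_k$, i.e., $G$ has an orientation containing no copy of $\mathrm{TT}_k$.
   Context: $\mathrm{TT}_k$ is the transitive tournament on $k$ vertices. $m(G)=\max\{e(J)/v(J):J\subseteq G,\ v(J)\ge1\}$ and $m_2(G)=\max\{(e(J)-1)/(v(J)-2):J\subseteq G,\ v(J)\ge3\}$ (so $m_2(K_k)=(k+1)/2$). *)

theory Defs
  imports Complex_Main "HOL-Library.Ramsey"
begin

type_synonym 'a graph = "'a set \<times> 'a set set"
type_synonym 'a digraph = "'a set \<times> ('a \<times> 'a) set"

definition simple_graph :: "'a graph \<Rightarrow> bool" where
  "simple_graph G \<longleftrightarrow> finite (fst G) \<and> snd G \<subseteq> [fst G]\<^bsup>2\<^esup>"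

definition subgraph :: "'a graph \<Rightarrow> 'a graph \<Rightarrow> bool" where
  "subgraph J G \<longleftrightarrow> simple_graph J \<and> fst J \<subseteq> fst G \<and> snd J \<subseteq> snd G"

abbreviation num_vertices :: "'a graph \<Rightarrow> nat" where
  "num_vertices G \<equiv> card (fst G)"

abbreviation num_edges :: "'a graph \<Rightarrow> nat" where
  "num_edges G \<equiv> card (snd G)"

(* In both densities the maximum is over the empty set, hence unspecified,
   if G has no vertex (resp. fewer than three vertices). *)

definition max_density :: "'a graph \<Rightarrow> real" where
  "max_density G = Max {real (num_edges J) / real (num_vertices J) | J. subgraph J G \<and> num_vertices J \<ge> 1}"

definition max_2_density :: "'a graph \<Rightarrow> real" where
  "max_2_density G =
     Max {(real (num_edges J) - 1) / (real (num_vertices J) - 2) | J. subgraph J G \<and> num_vertices J \<ge> 3}"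

definition complete_graph :: "nat \<Rightarrow> nat graph" where
  "complete_graph k = ({..<k}, [{..<k}]\<^bsup>2\<^esup>)"

definition transitive_tournament :: "nat \<Rightarrow> nat digraph" where
  "transitive_tournament k = ({..<k}, {(i, j). i < j \<and> j < k})"

(* The bijection says that each edge uv carries exactly one of the arcs (u,v), (v,u),
   and that there are no other arcs. *)
definition orientation :: "'a digraph \<Rightarrow> 'a graph \<Rightarrow> bool" where
  "orientation D G \<longleftrightarrow>
     fst D = fst G \<and> bij_betw (\<lambda>(u, w). {u, w}) (snd D) (snd G)"

(* Copies are not required to be induced. *)
definition contains_copy :: "'a digraph \<Rightarrow> 'b digraph \<Rightarrow> bool" where
  "contains_copy D H \<longleftrightarrow>
     (\<exists>f. inj_on f (fst H) \<and> f ` fst H \<subseteq> fst D \<and>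
          (\<forall>(x, y) \<in> snd H. (f x, f y) \<in> snd D))"

definition orient_arrow :: "'a graph \<Rightarrow> 'b digraph \<Rightarrow> bool" where
  "orient_arrow G H \<longleftrightarrow> (\<forall>D. orientation D G \<longrightarrow> contains_copy D H)"

end

theory Submission
  imports Defs
begin

text \<open>
  If \<open>m(G) < (k + 1) / 2\<close>, then every nonempty induced subgraph has a vertex of degree at most
  \<open>k\<close>, so the orientation can be built by adding vertices \<open>v\<close> with at most \<open>k\<close> earlier neighbours.
  It suffices that \<open>v\<close> lies on a cyclic triangle with an arc of every transitive
  \<open>(k - 1)\<close>-set of its neighbourhood \<open>N\<close>. If these sets share two vertices, one arc serves them
  all. Otherwise \<open>N\<close> is a tournament on \<open>k\<close> vertices in which the omitted vertices are exactly
  those of a cyclic triangle \<open>xyz\<close>; every further vertex \<open>w\<close> of \<open>N\<close> is then a source or a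
  sink towards \<open>x, y, z\<close>, and arcs at \<open>w\<close> serve all three sets.
\<close>

section \<open>Transitive sets of vertices\<close>

text \<open>For asymmetric \<open>A\<close> this says that \<open>X\<close> spans a transitive
  tournament, without naming the vertex order: totality plus the absence of cyclic triangles. One
  cyclic triangle therefore refutes it.\<close>

definition transitive_on :: "('a \<times> 'a) set \<Rightarrow> 'a set \<Rightarrow> bool" where
  "transitive_on A X \<longleftrightarrow>
     (\<forall>x\<in>X. \<forall>y\<in>X. x \<noteq> y \<longrightarrow> (x, y) \<in> A \<or> (y, x) \<in> A) \<and>
     \<not> (\<exists>x\<in>X. \<exists>y\<in>X. \<exists>z\<in>X. (x, y) \<in> A \<and> (y, z) \<in> A \<and> (z, x) \<in> A)"

lemma transitive_onD:
  "\<lbrakk>transitive_on A X; x \<in> X; y \<in> X; x \<noteq> y\<rbrakk> \<Longrightarrow> (x, y) \<in> A \<or> (y, x) \<in> A"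
  unfolding transitive_on_def by blast

lemma transitive_on_no_cycle:
  "\<lbrakk>transitive_on A X; x \<in> X; y \<in> X; z \<in> X; (x, y) \<in> A; (y, z) \<in> A\<rbrakk> \<Longrightarrow> (z, x) \<notin> A"
  unfolding transitive_on_def by blast

lemma transitive_on_cong:
  assumes "\<And>x y. \<lbrakk>x \<in> X; y \<in> X\<rbrakk> \<Longrightarrow> (x, y) \<in> A \<longleftrightarrow> (x, y) \<in> B"
  shows "transitive_on A X \<longleftrightarrow> transitive_on B X"
  unfolding transitive_on_def using assms by (simp cong: bex_cong ball_cong)

section \<open>Choosing the out-neighbours of a new vertex\<close>

lemma obtain_two_elements:
  assumes "card C \<ge> 2"
  obtains a b where "a \<in> C" "b \<in> C" "a \<noteq> b"
proof -
  have "\<not> is_singleton C" "C \<noteq> {}"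
    using assms by (auto simp: is_singleton_altdef)
  then show ?thesis using that by (metis is_singletonI')
qed

text \<open>Two common vertices lie in a transitive set, so they span an arc \<open>(p, q)\<close>,
  and \<open>U = {p}\<close> separates its ends in every member of \<open>F\<close>.\<close>

lemma out_set_from_common_pair:
  assumes "F \<noteq> {}" and F: "\<And>X. X \<in> F \<Longrightarrow> X \<subseteq> N \<and> transitive_on A X"
    and C: "card C \<ge> 2" "\<And>X. X \<in> F \<Longrightarrow> C \<subseteq> X"
  shows "\<exists>U\<subseteq>N. \<forall>X\<in>F. \<exists>a\<in>X \<inter> U. \<exists>b\<in>X - U. (a, b) \<in> A"
proof -
  obtain a b where ab: "a \<in> C" "b \<in> C" "a \<noteq> b"
    using obtain_two_elements C(1) by metis
  obtain X where X: "X \<in> F" using \<open>F \<noteq> {}\<close> by blast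
  have *: ?thesis if "p \<in> C" "q \<in> C" "p \<noteq> q" "(p, q) \<in> A" for p q
    using that C(2) F X by (intro exI[of _ "{p}"]) blast
  have "(a, b) \<in> A \<or> (b, a) \<in> A"
    using ab C(2)[OF X] F[OF X] by (meson subsetD transitive_onD)
  then show ?thesis using *[of a b] *[of b a] ab by blast
qed

text \<open>\<open>U\<close> is to become the out-neighbourhood of a new vertex \<open>v\<close>
  with neighbourhood \<open>N\<close>, and \<open>N - U\<close> its in-neighbourhood. An arc from
  \<open>a\<close> in \<open>U\<close> to \<open>b\<close> outside \<open>U\<close> then closes the
  cyclic triangle \<open>v\<close>, \<open>a\<close>, \<open>b\<close>.\<close>

lemma out_set_exists:
  assumes "k \<ge> 4" and "finite N" and "card N \<le> k" and "asym A"
    and free: "\<And>X. \<lbrakk>X \<subseteq> N; card X = k\<rbrakk> \<Longrightarrow> \<not> transitive_on A X"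
  shows "\<exists>U\<subseteq>N. \<forall>X. X \<subseteq> N \<and> card X = k - 1 \<and> transitive_on A X \<longrightarrow>
           (\<exists>a\<in>X \<inter> U. \<exists>b\<in>X - U. (a, b) \<in> A)"
proof -
  define F where "F = {X. X \<subseteq> N \<and> card X = k - 1 \<and> transitive_on A X}"
  \<comment> \<open>If \<open>card N = k\<close>, the members of \<open>F\<close> are exactly the
    sets \<open>N - {u}\<close> with \<open>u\<close> in \<open>S\<close>.\<close>
  define S where "S = {u \<in> N. N - {u} \<in> F}"
  have FD: "X \<subseteq> N \<and> transitive_on A X" if "X \<in> F" for X
    using that by (simp add: F_def)
  have omit: "\<exists>u\<in>S. X = N - {u}" if X: "X \<in> F" and "card N = k" for X
  proof -
    have "card (N - X) = 1"
      using X \<open>card N = k\<close> \<open>k \<ge> 4\<close> \<open>finite N\<close>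
      by (subst card_Diff_subset) (auto simp: F_def intro: finite_subset)
    then obtain u where u: "N - X = {u}" by (auto simp: card_1_singleton_iff)
    then have "X = N - {u}" using X by (auto simp: F_def)
    then show ?thesis using u X by (auto simp: S_def)
  qed
  have "\<exists>U\<subseteq>N. \<forall>X\<in>F. \<exists>a\<in>X \<inter> U. \<exists>b\<in>X - U. (a, b) \<in> A"
  proof (cases "F = {}")
    case False
    consider "card N < k" | "card N = k" "card S \<le> 2" | "card N = k" "card S \<ge> 3"
      using \<open>card N \<le> k\<close> by linarith
    then show ?thesis
    proof cases
      case 1
      have "X = N" if "X \<in> F" for X
      proof (rule card_seteq[OF \<open>finite N\<close>])
        show "X \<subseteq> N" "card N \<le> card X" using that 1 by (auto simp: F_def)
      qed
      moreover from this have "card N = k - 1" using False by (auto simp: F_def)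
      ultimately show ?thesis
        using out_set_from_common_pair[OF False FD, of N] \<open>k \<ge> 4\<close> by auto
    next
      case 2
      have "N - S \<subseteq> X" if "X \<in> F" for X
        using omit[OF that 2(1)] by blast
      \<comment> \<open>At least \<open>k - 2\<close> vertices remain, which is where
        \<open>k >= 4\<close> enters.\<close>
      moreover have "card (N - S) \<ge> 2"
        using 2 \<open>k \<ge> 4\<close> \<open>finite N\<close>
        by (subst card_Diff_subset) (auto simp: S_def)
      ultimately show ?thesis
        using out_set_from_common_pair[OF False FD, of "N - S"] by auto
    next
      case 3
      have Str: "transitive_on A (N - {u})" if "u \<in> S" for u
        using that by (simp add: S_def F_def)
      \<comment> \<open>With three elements in \<open>S\<close>, some \<open>u\<close> in
        \<open>S\<close> avoids both \<open>p\<close> and \<open>q\<close>, so both lie in the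
        transitive set \<open>N - {u}\<close>.\<close>
      have "(p, q) \<in> A \<or> (q, p) \<in> A" if "p \<in> N" "q \<in> N" "p \<noteq> q" for p q
      proof -
        have "\<not> S \<subseteq> {p, q}"
          using 3(2) card_mono[of "{p, q}" S] \<open>p \<noteq> q\<close> by auto
        then obtain u where "u \<in> S" "u \<noteq> p" "u \<noteq> q" by blast
        then show ?thesis using Str that by (auto dest!: transitive_onD[of _ _ p q])
      qed
      \<comment> \<open>\<open>N\<close> is total but, having \<open>k\<close> vertices, not
        transitive by \<open>free\<close>; hence it contains a cyclic triangle.\<close>
      then obtain x y z where xyz: "x \<in> N" "y \<in> N" "z \<in> N"
          "(x, y) \<in> A" "(y, z) \<in> A" "(z, x) \<in> A"
        and total: "\<And>p q. \<lbrakk>p \<in> N; q \<in> N; p \<noteq> q\<rbrakk> \<Longrightarrow> (p, q) \<in> A \<or> (q, p) \<in> A"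
        using free[of N] 3(1) unfolding transitive_on_def by blast
      have irr: "(p, p) \<notin> A" for p using \<open>asym A\<close> by (meson asymD)
      \<comment> \<open>If \<open>u\<close> in \<open>S\<close> were off the triangle, the
        transitive set \<open>N - {u}\<close> would contain it.\<close>
      have Ssub: "S \<subseteq> {x, y, z}"
        using Str xyz unfolding transitive_on_def by blast
      have S: "S = {x, y, z}"
        by (rule card_seteq) (use Ssub 3(2) in \<open>auto simp: card_insert_if\<close>)
      have no_cycle: "(r, p) \<notin> A" if "u \<in> S" "{p, q, r} \<subseteq> N - {u}" "(p, q) \<in> A" "(q, r) \<in> A" for p q r u
        using Str[OF that(1)] that(2-) by (auto dest: transitive_on_no_cycle)
      have "\<not> N \<subseteq> {x, y, z}"
      proof
        assume "N \<subseteq> {x, y, z}"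
        then have "card N \<le> card {x, y, z}" by (intro card_mono) auto
        also have "\<dots> \<le> 3" by (simp add: card_insert_if)
        finally show False using 3(1) \<open>k \<ge> 4\<close> by simp
      qed
      then obtain w where w: "w \<in> N" "w \<noteq> x" "w \<noteq> y" "w \<noteq> z" by blast
      have ne: "x \<noteq> y" "y \<noteq> z" "x \<noteq> z" using xyz irr by auto
      have FX: "X = N - {x} \<or> X = N - {y} \<or> X = N - {z}" if "X \<in> F" for X
        using omit[OF that 3(1)] S by blast
      show ?thesis
      proof (cases "(w, x) \<in> A")
        case True
        \<comment> \<open>Otherwise \<open>w\<close>, \<open>x\<close>, \<open>y\<close> would form
          a cyclic triangle missing \<open>z\<close>. Every member of \<open>F\<close> contains
          \<open>w\<close> and at least one of \<open>x\<close>, \<open>y\<close>, so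
          \<open>U = {w}\<close> works.\<close>
        have wy: "(w, y) \<in> A"
          using no_cycle[of z w x y] total[of w y] True xyz w ne S by auto
        have "\<exists>a\<in>X \<inter> {w}. \<exists>b\<in>X - {w}. (a, b) \<in> A" if "X \<in> F" for X
          using FX[OF that] True wy w xyz ne by auto
        then show ?thesis using w(1) by (intro exI[of _ "{w}"]) blast
      next
        case False
        then have xw: "(x, w) \<in> A" using total w xyz by blast
        \<comment> \<open>Otherwise \<open>z\<close>, \<open>x\<close>, \<open>w\<close> would form
          a cyclic triangle missing \<open>y\<close>. Every member of \<open>F\<close> keeps
          \<open>x\<close> or \<open>z\<close>, and \<open>w\<close> is the only vertex outside
          \<open>U = N - {w}\<close>.\<close>
        have zw: "(z, w) \<in> A"
          using no_cycle[of y z x w] total[of w z] xw xyz w ne S by auto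
        have "\<exists>a\<in>X \<inter> (N - {w}). \<exists>b\<in>X - (N - {w}). (a, b) \<in> A" if "X \<in> F" for X
          using FX[OF that] xw zw w xyz ne by auto
        then show ?thesis by (intro exI[of _ "N - {w}"]) blast
      qed
    qed
  qed auto
  then show ?thesis by (simp add: F_def)
qed

section \<open>Orienting degenerate graphs\<close>

lemma degenerate_orientation:
  assumes "k \<ge> 4" and "finite V"
    and degenerate: "\<And>W. \<lbrakk>W \<subseteq> V; W \<noteq> {}\<rbrakk> \<Longrightarrow> \<exists>w\<in>W. card {u \<in> W. u \<noteq> w \<and> {u, w} \<in> E} \<le> k"
  shows "\<exists>A. asym A \<and>
    (\<forall>u w. (u, w) \<in> A \<or> (w, u) \<in> A \<longleftrightarrow> u \<in> V \<and> w \<in> V \<and> u \<noteq> w \<and> {u, w} \<in> E) \<and>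
    (\<forall>X\<subseteq>V. card X = k \<longrightarrow> \<not> transitive_on A X)"
  using \<open>finite V\<close> degenerate
proof (induction V rule: finite_psubset_induct)
  case (psubset V)
  show ?case
  proof (cases "V = {}")
    case True
    then show ?thesis using \<open>k \<ge> 4\<close> by (intro exI[of _ "{}"]) (auto intro: asymI)
  next
    case False
    then obtain v where v: "v \<in> V" and deg: "card {u \<in> V. u \<noteq> v \<and> {u, v} \<in> E} \<le> k"
      using psubset.prems[of V] by blast
    define N where "N = {u \<in> V. u \<noteq> v \<and> {u, v} \<in> E}"
    have "V - {v} \<subset> V" using v by blast
    moreover have "\<exists>w\<in>W. card {u \<in> W. u \<noteq> w \<and> {u, w} \<in> E} \<le> k"
      if "W \<subseteq> V - {v}" "W \<noteq> {}" for W
      using that by (intro psubset.prems) auto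
    ultimately have "\<exists>A. asym A \<and>
        (\<forall>u w. (u, w) \<in> A \<or> (w, u) \<in> A \<longleftrightarrow>
           u \<in> V - {v} \<and> w \<in> V - {v} \<and> u \<noteq> w \<and> {u, w} \<in> E) \<and>
        (\<forall>X\<subseteq>V - {v}. card X = k \<longrightarrow> \<not> transitive_on A X)"
      by (rule psubset.IH)
    then obtain A where A: "asym A"
      and arcs: "\<And>u w. (u, w) \<in> A \<or> (w, u) \<in> A \<longleftrightarrow>
            u \<in> V - {v} \<and> w \<in> V - {v} \<and> u \<noteq> w \<and> {u, w} \<in> E"
      and free: "\<And>X. \<lbrakk>X \<subseteq> V - {v}; card X = k\<rbrakk> \<Longrightarrow> \<not> transitive_on A X"
      by (elim exE conjE) simp
    have "finite N" using psubset.hyps by (auto simp: N_def)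
    moreover have "\<not> transitive_on A X" if "X \<subseteq> N" "card X = k" for X
      using free[of X] that by (auto simp: N_def)
    ultimately obtain U where U: "U \<subseteq> N"
      and tri: "\<And>X. \<lbrakk>X \<subseteq> N; card X = k - 1; transitive_on A X\<rbrakk> \<Longrightarrow>
              \<exists>a\<in>X \<inter> U. \<exists>b\<in>X - U. (a, b) \<in> A"
      using out_set_exists[OF \<open>k \<ge> 4\<close>, of N A] deg A unfolding N_def[symmetric] by metis
    define B where "B = A \<union> {v} \<times> U \<union> (N - U) \<times> {v}"
    \<comment> \<open>\<open>A\<close> only joins vertices of \<open>V - {v}\<close>, so the new
      arcs at \<open>v\<close> cannot conflict with it.\<close>
    have vA: "(v, u) \<notin> A" "(u, v) \<notin> A" for u using arcs[of u v] by auto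
    have vN: "v \<notin> N" by (simp add: N_def)
    have "asym B"
      using A vA vN U by (auto simp: B_def asym_iff)
    moreover have arcsB: "(u, w) \<in> B \<or> (w, u) \<in> B \<longleftrightarrow> u \<in> V \<and> w \<in> V \<and> u \<noteq> w \<and> {u, w} \<in> E" for u w
    proof -
      have "(u, w) \<in> B \<or> (w, u) \<in> B \<longleftrightarrow>
          ((u, w) \<in> A \<or> (w, u) \<in> A) \<or> (u = v \<and> w \<in> N) \<or> (w = v \<and> u \<in> N)"
        using U by (auto simp: B_def)
      also have "\<dots> \<longleftrightarrow> u \<in> V \<and> w \<in> V \<and> u \<noteq> w \<and> {u, w} \<in> E"
        unfolding arcs using v by (auto simp: N_def insert_commute)
      finally show ?thesis .
    qed
    moreover have "\<not> transitive_on B X" if X: "X \<subseteq> V" "card X = k" for X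
    proof
      assume trans: "transitive_on B X"
      define Y where "Y = X - {v}"
      have "transitive_on B Y"
        using trans unfolding transitive_on_def Y_def by blast
      then have Y: "transitive_on A Y"
        by (subst transitive_on_cong[of Y A B]) (auto simp: B_def Y_def)
      have "v \<in> X"
      proof (rule ccontr)
        assume "v \<notin> X"
        then have "Y = X" by (auto simp: Y_def)
        then show False using free[of X] X Y \<open>v \<notin> X\<close> by blast
      qed
      \<comment> \<open>Totality of \<open>X\<close> makes all its other vertices neighbours of
        \<open>v\<close>; so \<open>Y\<close> is one of the sets that \<open>U\<close> was chosen to
        handle.\<close>
      have "u \<in> N" if "u \<in> Y" for u
        using transitive_onD[OF trans, of u v] arcsB[of u v] that \<open>v \<in> X\<close> by (auto simp: Y_def N_def)
      moreover have "card Y = k - 1"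
        using X \<open>v \<in> X\<close> psubset.hyps by (auto simp: Y_def card_Diff_singleton)
      ultimately obtain a b where "a \<in> Y \<inter> U" "b \<in> Y - U" "(a, b) \<in> A"
        using tri[of Y] Y by blast
      moreover from this have "b \<in> N" using \<open>\<And>u. u \<in> Y \<Longrightarrow> u \<in> N\<close> by blast
      ultimately have "a \<in> X" "b \<in> X" "(v, a) \<in> B" "(a, b) \<in> B" "(b, v) \<in> B"
        by (auto simp: B_def Y_def)
      then show False using transitive_on_no_cycle[OF trans \<open>v \<in> X\<close>, of a b] by blast
    qed
    ultimately show ?thesis by blast
  qed
qed

text \<open>Asymmetry makes every arc between images increase the index, so a cyclic triangle would
  give \<open>h < i < j < h\<close>.\<close>

lemma transitive_on_copy:
  assumes "asym A" and arc: "\<And>i j. \<lbrakk>i < j; j < k\<rbrakk> \<Longrightarrow> (f i, f j) \<in> A"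
  shows "transitive_on A (f ` {..<k::nat})"
proof -
  have lt: "i < j" if "(f i, f j) \<in> A" "i < k" "j < k" for i j
  proof (rule ccontr)
    assume "\<not> i < j"
    then consider "i = j" | "j < i" by linarith
    then show False
      using that arc[of j i] \<open>asym A\<close> by cases (auto dest: asymD)
  qed
  show ?thesis
    unfolding transitive_on_def
  proof (intro conjI ballI impI notI)
    fix x y assume "x \<in> f ` {..<k}" "y \<in> f ` {..<k}" "x \<noteq> y"
    then obtain i j where "i < k" "j < k" "x = f i" "y = f j" "i \<noteq> j" by auto
    then show "(x, y) \<in> A \<or> (y, x) \<in> A"
      using arc[of i j] arc[of j i] by (cases "i < j") auto
  next
    assume "\<exists>x\<in>f ` {..<k}. \<exists>y\<in>f ` {..<k}. \<exists>z\<in>f ` {..<k}. (x, y) \<in> A \<and> (y, z) \<in> A \<and> (z, x) \<in> A"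
    then obtain h i j where "h < k" "i < k" "j < k"
      "(f h, f i) \<in> A" "(f i, f j) \<in> A" "(f j, f h) \<in> A" by auto
    then show False using lt[of h i] lt[of i j] lt[of j h] by simp
  qed
qed

section \<open>Densities\<close>

lemma finite_subgraphs:
  assumes "simple_graph G"
  shows "finite {J. subgraph J G}"
proof (rule finite_subset)
  show "{J. subgraph J G} \<subseteq> Pow (fst G) \<times> Pow (Pow (fst G))"
    using assms by (force simp: subgraph_def simple_graph_def nsets_def)
  show "finite (Pow (fst G) \<times> Pow (Pow (fst G)))"
    using assms by (simp add: simple_graph_def)
qed

lemma max_density_ge:
  assumes "simple_graph G" "subgraph J G" "num_vertices J \<ge> 1"
  shows "real (num_edges J) / real (num_vertices J) \<le> max_density G"
proof -
  let ?g = "\<lambda>J. real (num_edges J) / real (num_vertices J)"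
  have "{?g J | J. subgraph J G \<and> num_vertices J \<ge> 1} \<subseteq> ?g ` {J. subgraph J G}"
    by blast
  then have "finite {?g J | J. subgraph J G \<and> num_vertices J \<ge> 1}"
    using finite_subgraphs[OF assms(1)] finite_surj by blast
  then show ?thesis
    unfolding max_density_def using assms by (intro Max_ge) blast+
qed

lemma simple_graph_complete_graph: "simple_graph (complete_graph k)"
  by (simp add: simple_graph_def complete_graph_def)

text \<open>A subgraph on \<open>n\<close> vertices has at most \<open>n choose 2\<close> edges, and
  \<open>(n choose 2) - 1 = (n + 1) * (n - 2) / 2\<close>; then \<open>n <= k\<close>.\<close>

lemma max_2_density_complete_graph_le:
  assumes "k \<ge> 3"
  shows "max_2_density (complete_graph k) \<le> (real k + 1) / 2"
proof -
  let ?g = "\<lambda>J. (real (num_edges J) - 1) / (real (num_vertices J) - 2)"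
  let ?M = "{?g J | J. subgraph J (complete_graph k) \<and> num_vertices J \<ge> 3}"
  have "?M \<subseteq> ?g ` {J. subgraph J (complete_graph k)}"
    by blast
  then have "finite ?M"
    using finite_subgraphs[OF simple_graph_complete_graph] finite_surj by blast
  \<comment> \<open>\<open>Max\<close> can be bounded only over a nonempty set; the complete graph
    itself is the witness.\<close>
  moreover have "?M \<noteq> {}"
  proof -
    have "subgraph (complete_graph k) (complete_graph k)"
      by (simp add: subgraph_def simple_graph_complete_graph)
    moreover have "num_vertices (complete_graph k) \<ge> 3"
      using assms by (simp add: complete_graph_def)
    ultimately show ?thesis by blast
  qed
  moreover have "?g J \<le> (real k + 1) / 2"
    if J: "subgraph J (complete_graph k)" "num_vertices J \<ge> 3" for J
  proof -
    let ?n = "num_vertices J"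
    have "fst J \<subseteq> {..<k}" and sub: "snd J \<subseteq> [fst J]\<^bsup>2\<^esup>" and fin: "finite (fst J)"
      using J by (auto simp: subgraph_def complete_graph_def simple_graph_def)
    then have "?n \<le> k" using card_mono[of "{..<k}" "fst J"] by simp
    have "num_edges J \<le> ?n choose 2"
      using card_mono[OF finite_imp_finite_nsets[OF fin] sub] by simp
    also have "real (?n choose 2) = real ?n * (real ?n - 1) / 2"
      using J(2) by (simp add: choose_two real_of_nat_div of_nat_diff)
    finally have "real (num_edges J) - 1 \<le> (real ?n + 1) / 2 * (real ?n - 2)"
      by (simp add: field_simps)
    also have "\<dots> \<le> (real k + 1) / 2 * (real ?n - 2)"
      using \<open>?n \<le> k\<close> J(2) by (intro mult_right_mono) auto
    finally show ?thesis using J(2) by (simp add: pos_divide_le_eq)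
  qed
  ultimately show ?thesis
    unfolding max_2_density_def by (subst Max_le_iff) auto
qed

text \<open>If all degrees inside \<open>W\<close> were at least \<open>k + 1\<close>, the handshake
  identity would give the subgraph induced by \<open>W\<close> density at least
  \<open>(k + 1) / 2\<close>.\<close>

lemma low_degree_vertex:
  assumes "simple_graph G" and dens: "max_density G < (real k + 1) / 2"
    and W: "W \<subseteq> fst G" "W \<noteq> {}"
  shows "\<exists>w\<in>W. card {u \<in> W. u \<noteq> w \<and> {u, w} \<in> snd G} \<le> k"
proof (rule ccontr)
  assume "\<not> ?thesis"
  then have high: "k + 1 \<le> card {u \<in> W. u \<noteq> w \<and> {u, w} \<in> snd G}" if "w \<in> W" for w
    using that by force
  have finW: "finite W" using assms by (auto simp: simple_graph_def intro: finite_subset)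
  define E where "E = snd G \<inter> Pow W"
  have finE: "finite E" using finW by (simp add: E_def)
  have two: "card e = 2" if "e \<in> E" for e
    using that assms(1) by (auto simp: E_def simple_graph_def nsets_def)
  have "subgraph (W, E) G"
    using assms finW two by (auto simp: subgraph_def simple_graph_def E_def nsets_def)
  moreover have "card W > 0" using finW W by (simp add: card_gt_0_iff)
  ultimately have "real (card E) / real (card W) < (real k + 1) / 2"
    using max_density_ge[OF assms(1), of "(W, E)"] dens by (intro le_less_trans[OF _ dens]) simp
  then have "2 * real (card E) < (real k + 1) * real (card W)"
    using \<open>card W > 0\<close> by (simp add: field_simps)
  moreover have "(k + 1) * card W \<le> 2 * card E"
  proof -
    have "k + 1 \<le> card {e \<in> E. w \<in> e}" if "w \<in> W" for w
    proof -
      have "card {u \<in> W. u \<noteq> w \<and> {u, w} \<in> snd G} \<le> card {e \<in> E. w \<in> e}"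
      proof (rule card_inj_on_le[where f = "\<lambda>u. {u, w}"])
        show "inj_on (\<lambda>u. {u, w}) {u \<in> W. u \<noteq> w \<and> {u, w} \<in> snd G}"
          by (auto simp: inj_on_def doubleton_eq_iff)
      qed (use that finE in \<open>auto simp: E_def intro: finite_subset[OF _ finE[unfolded E_def]]\<close>)
      with high[OF that] show ?thesis by linarith
    qed
    then have "(k + 1) * card W \<le> (\<Sum>w\<in>W. card {e \<in> E. w \<in> e})"
      using sum_bounded_below[of W "k + 1" "\<lambda>w. card {e \<in> E. w \<in> e}"] by (simp add: mult.commute)
    \<comment> \<open>Each edge within \<open>W\<close> is counted once at each of its two
      ends.\<close>
    also have "\<dots> = 2 * card E"
    proof (rule sum_multicount[OF finW finE], intro ballI)
      fix e assume "e \<in> E"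
      then have "{w \<in> W. w \<in> e} = e" by (auto simp: E_def)
      then show "card {w \<in> W. w \<in> e} = 2" using two[OF \<open>e \<in> E\<close>] by simp
    qed
    finally show ?thesis .
  qed
  then have "real ((k + 1) * card W) \<le> real (2 * card E)"
    by (rule of_nat_mono)
  ultimately show False by (simp add: algebra_simps)
qed

section \<open>From arc sets to orientations, and the theorem\<close>

text \<open>Asymmetry keeps an edge from carrying both arcs, which gives injectivity;
  \<open>arcs\<close> makes the image exactly \<open>E\<close>.\<close>

lemma orientationI:
  assumes "simple_graph (V, E)" and "asym A"
    and arcs: "\<And>u w. (u, w) \<in> A \<or> (w, u) \<in> A \<longleftrightarrow> u \<in> V \<and> w \<in> V \<and> u \<noteq> w \<and> {u, w} \<in> E"
  shows "orientation (V, A) (V, E)"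
proof -
  have "inj_on (\<lambda>(u, w). {u, w}) A"
    using \<open>asym A\<close> by (auto simp: inj_on_def doubleton_eq_iff dest: asymD)
  moreover have "(\<lambda>(u, w). {u, w}) ` A = E"
  proof (intro equalityI subsetI)
    fix e assume "e \<in> (\<lambda>(u, w). {u, w}) ` A"
    then obtain u w where "e = {u, w}" "(u, w) \<in> A" by auto
    then show "e \<in> E" using arcs[of u w] by blast
  next
    fix e assume e: "e \<in> E"
    then have "e \<subseteq> V" "card e = 2" using assms(1) by (auto simp: simple_graph_def nsets_def)
    then obtain u w where uw: "e = {u, w}" "u \<noteq> w" by (auto simp: card_2_iff)
    then have "(u, w) \<in> A \<or> (w, u) \<in> A" using arcs[of u w] e \<open>e \<subseteq> V\<close> by auto
    then show "e \<in> (\<lambda>(u, w). {u, w}) ` A" using uw by (force simp: insert_commute)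
  qed
  ultimately show ?thesis by (simp add: orientation_def bij_betw_def)
qed

theorem theorem12:
  fixes k :: nat and G :: "'a graph"
  assumes "k \<ge> 4"
    and "simple_graph G"
    and "max_density G < max_2_density (complete_graph k)"
  shows "\<not> orient_arrow G (transitive_tournament k)"
proof -
  have "max_density G < (real k + 1) / 2"
    using assms max_2_density_complete_graph_le[of k] by linarith
  moreover have "finite (fst G)" using assms(2) by (simp add: simple_graph_def)
  ultimately have "\<exists>A. asym A \<and>
      (\<forall>u w. (u, w) \<in> A \<or> (w, u) \<in> A \<longleftrightarrow>
         u \<in> fst G \<and> w \<in> fst G \<and> u \<noteq> w \<and> {u, w} \<in> snd G) \<and>
      (\<forall>X\<subseteq>fst G. card X = k \<longrightarrow> \<not> transitive_on A X)"
    using assms(1,2) by (intro degenerate_orientation low_degree_vertex)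
  then obtain A where A: "asym A"
    and arcs: "\<And>u w. (u, w) \<in> A \<or> (w, u) \<in> A \<longleftrightarrow>
          u \<in> fst G \<and> w \<in> fst G \<and> u \<noteq> w \<and> {u, w} \<in> snd G"
    and free: "\<And>X. \<lbrakk>X \<subseteq> fst G; card X = k\<rbrakk> \<Longrightarrow> \<not> transitive_on A X"
    by (elim exE conjE) simp
  have "orientation (fst G, A) G"
    using orientationI[of "fst G" "snd G" A] assms(2) A arcs by simp
  moreover have "\<not> contains_copy (fst G, A) (transitive_tournament k)"
  proof
    assume "contains_copy (fst G, A) (transitive_tournament k)"
    then obtain f where f: "inj_on f {..<k}" "f ` {..<k} \<subseteq> fst G"
      "\<And>i j. \<lbrakk>i < j; j < k\<rbrakk> \<Longrightarrow> (f i, f j) \<in> A"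
      by (auto simp: contains_copy_def transitive_tournament_def)
    have "transitive_on A (f ` {..<k})"
      using f(3) by (rule transitive_on_copy[OF A])
    \<comment> \<open>Injectivity of \<open>f\<close> gives the image exactly \<open>k\<close>
      vertices, so \<open>free\<close> applies.\<close>
    then show False using free[OF f(2)] f(1) by (simp add: card_image)
  qed
  ultimately show ?thesis by (auto simp: orient_arrow_def)
qed

end
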